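(* Let $C\subset\mathbb{R}^n$ and $Q\subset\mathbb{R}^m$ be nonempty closed convex sets, and let the set-valued map $S:\mathbb{R}^{l\times n}\times\mathbb{R}^{l\times m}\rightrightarrows\mathbb{R}^n\times\mathbb{R}^m$ be defined by $$S(A,B):=\{(x,y)\in C\times Q \,:\, Ax=By\},\qquad (A,B)\in\mathbb{R}^{l\times n}\times\mathbb{R}^{l\times m}.$$ Let $(\bar A,\bar B)\in\mathbb{R}^{l\times n}\times\mathbb{R}^{l\times m}$ and $(\bar x,\bar y)\in S(\bar A,\bar B)$. Consider the condition $$(\ast)\qquad (\bar A^{\mathrm T})^{-1}\big(-N(\bar x;C)\big)\cap(\bar B^{\mathrm T})^{-1}\big(N(\bar y;Q)\big)=\{0\}.$$ If $(\ast)$ holds, then $S$ is Lipschitz-like at $\big((\bar A,\bar B),(\bar x,\bar y)\big)$. Conversely, if $S$ is Lipschitz-like at $\big((\bar A,\bar B),(\bar x,\bar y)\big)$ and $(\bar x,\bar y)\neq(0,0)$, then $(\ast)$ holds.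
   Context: $S$ is the solution map of the split equality problem (find $x\in C$, $y\in Q$ with $Ax=By$); the sets $C,Q$ are fixed and the matrices $A,B$ are perturbed. Product spaces carry the sum norm $\|(a,b)\|=\|a\|+\|b\|$. For a convex set $\Omega\subset\mathbb{R}^p$ and $\bar x\in\Omega$, the normal cone is $N(\bar x;\Omega)=\{x'\in\mathbb{R}^p : \langle x',x-\bar x\rangle\le 0\ \ \forall x\in\Omega\}$ (for convex sets the limiting normal cone coincides with this one). For a matrix $M\in\mathbb{R}^{q\times p}$, $M^{\mathrm T}$ is its transpose, and for $\Omega\subset\mathbb{R}^q$, $M^{-1}(\Omega)=\{x\in\mathbb{R}^p : Mx\in\Omega\}$ denotes the preimage ($M$ need not be invertible). Thus $(\bar A^{\mathrm T})^{-1}(-N(\bar x;C))=\{z\in\mathbb{R}^l : \bar A^{\mathrm T}z\in -N(\bar x;C)\}$ and $(\bar B^{\mathrm T})^{-1}(N(\bar y;Q))=\{z\in\mathbb{R}^l : \bar B^{\mathrm T}z\in N(\bar y;Q)\}$. A set-valued map $\Phi:X\rightrightarrows Y$ between normed spaces is Lipschitz-like (pseudo-Lipschitz, has the Aubin property) at $(\bar p,\bar q)$ with $\bar q\in\Phi(\bar p)$ if there exist neighborhoods $U$ of $\bar p$ and $V$ of $\bar q$ and a constant $\ell>0$ such that $\Phi(p')\cap V\subset\Phi(p)+\ell\|p'-p\|\,\overline{\mathbb{B}}_Y$ for all $p,p'\in U$, where $\overline{\mathbb{B}}_Y$ is the closed unit ball of $Y$. *)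

theory Defs
  imports "HOL-Analysis.Analysis"
begin

text \<open>
  The library equips product types with the Euclidean norm
  \<open>sqrt (norm a ^ 2 + norm b ^ 2)\<close>, so the sum norm is introduced separately. The two bounds
  show that it induces the topology of the product type.
\<close>

definition sum_norm :: "'a::real_normed_vector \<times> 'b::real_normed_vector \<Rightarrow> real" where
  "sum_norm p = norm (fst p) + norm (snd p)"

lemma norm_le_sum_norm: "norm p \<le> sum_norm p"
  using norm_Pair_le[of "fst p" "snd p"] by (simp add: sum_norm_def)

lemma sum_norm_le_norm: "sum_norm p \<le> 2 * norm p"
  using norm_fst_le[of "fst p" "snd p"] norm_snd_le[of "snd p" "fst p"]
  by (simp add: sum_norm_def)

text \<open>Only meant for a base point \<open>x \<in> \<Omega>\<close> and a convex set \<open>\<Omega>\<close>.\<close>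

definition normal_cone :: "'a::real_inner \<Rightarrow> 'a set \<Rightarrow> 'a set" where
  "normal_cone x \<Omega> = {x'. \<forall>u\<in>\<Omega>. x' \<bullet> (u - x) \<le> 0}"

text \<open>
  The norms \<open>nX\<close> and \<open>nY\<close> of the two spaces are parameters, because on product types the norm
  intended need not be the one of the type class. They have to induce the topology of the type,
  which is the one that determines the neighbourhoods (\<open>U\<close> is a neighbourhood of \<open>p\<close> iff
  \<open>p \<in> interior U\<close>).
\<close>

definition lipschitz_like ::
  "('a::real_normed_vector \<Rightarrow> real) \<Rightarrow> ('b::real_normed_vector \<Rightarrow> real) \<Rightarrow>
    ('a \<Rightarrow> 'b set) \<Rightarrow> 'a \<Rightarrow> 'b \<Rightarrow> bool" where
  "lipschitz_like nX nY \<Phi> pbar qbar \<longleftrightarrow>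
     qbar \<in> \<Phi> pbar \<and>
     (\<exists>U V. \<exists>L>0. pbar \<in> interior U \<and> qbar \<in> interior V \<and>
       (\<forall>p\<in>U. \<forall>p'\<in>U.
         \<Phi> p' \<inter> V \<subseteq> {q + (L * nX (p' - p)) *\<^sub>R b |q b. q \<in> \<Phi> p \<and> nY b \<le> 1}))"

definition sep_solution ::
  "(real ^ 'n) set \<Rightarrow> (real ^ 'm) set \<Rightarrow> (real ^ 'n ^ 'l) \<times> (real ^ 'm ^ 'l)
    \<Rightarrow> ((real ^ 'n) \<times> (real ^ 'm)) set" where
  "sep_solution C Q = (\<lambda>(A, B). {(x, y) \<in> C \<times> Q. A *v x = B *v y})"

end

theory Submission
  imports Defs
begin

text \<open>
  Write \<open>\<Omega> = C \<times> Q\<close> and \<open>w = (x, y)\<close>. The constraint \<open>A x = B y\<close> reads \<open>G p w = 0\<close> with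
  \<open>G (A, B) (x, y) = A x - B y\<close>, which is bilinear in the parameter \<open>p = (A, B)\<close> and \<open>w\<close>.
  Since \<open>G pbar wbar = 0\<close>, a vector \<open>z\<close> lies in the intersection of the two preimages of
  normal cones exactly if \<open>z \<bullet> G pbar w \<ge> 0\<close> for all \<open>w \<in> \<Omega>\<close> (\<open>dual_cone_condition_iff\<close>).
  The condition of the theorem therefore says that no hyperplane supports the convex set
  \<open>G pbar ` \<Omega>\<close> at \<open>0\<close>, that is, that \<open>0\<close> is an interior point of it.

  If the condition holds, then already the image of the compact piece \<open>D\<close> of \<open>\<Omega>\<close> within
  distance \<open>1\<close> of \<open>wbar\<close> contains a ball around \<open>0\<close>, say of radius \<open>r\<close>. The operators \<open>G p\<close>
  with \<open>p\<close> near \<open>pbar\<close> are uniformly close to \<open>G pbar\<close> on \<open>D\<close>, so a separation argument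
  shows that \<open>G p ` D\<close> still contains the ball of radius \<open>r / 2\<close>
  (\<open>cball_subset_perturbed_image\<close>). A solution \<open>w\<close> for a parameter \<open>p'\<close> violates the
  constraint for \<open>p\<close> by \<open>G (p - p') w\<close>, which is of order \<open>norm (p' - p)\<close>. Moving \<open>w\<close> a
  proportional distance towards a point of \<open>D\<close> with opposite residual cancels the violation
  and stays in \<open>\<Omega>\<close> by convexity (\<open>convex_solution_near\<close>). This is the Lipschitz estimate.

  Conversely, let \<open>z \<noteq> 0\<close> satisfy \<open>z \<bullet> G pbar w \<ge> 0\<close> on \<open>\<Omega>\<close>. If \<open>wbar \<noteq> 0\<close>, a rank-one
  matrix gives a direction \<open>p\<close> with \<open>G p wbar = z\<close>. For \<open>t > 0\<close> every \<open>w \<in> \<Omega>\<close> near \<open>wbar\<close> then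
  has \<open>z \<bullet> G (pbar + t p) w > 0\<close>, so the perturbed problem has no solution near \<open>wbar\<close>,
  whereas a Lipschitz-like map would have one at distance of order \<open>t\<close>.

  Both implications hold for an arbitrary bounded bilinear \<open>G\<close>, the second as soon as the
  direction \<open>p\<close> exists. Matrices enter only through this rank-one direction and through the
  translation of the normal cone condition.
\<close>

section \<open>Zero as an interior point of a linear image of a convex set\<close>

text \<open>
  If \<open>0\<close> is not interior, it is separated from the interior, and the separating half-space
  contains the closure of the interior, which is all of \<open>closure K\<close>. This breaks down for
  empty interior, but then \<open>K\<close> lies in a hyperplane, which passes through \<open>0 \<in> K\<close>.
\<close>

lemma convex_zero_in_interior:
  fixes K :: "'a::euclidean_space set"
  assumes "convex K" and "0 \<in> K"
    and sep: "\<And>z. (\<And>k. k \<in> K \<Longrightarrow> 0 \<le> z \<bullet> k) \<Longrightarrow> z = 0"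
  shows "0 \<in> interior K"
proof (rule ccontr)
  assume "0 \<notin> interior K"
  then obtain a where a: "a \<noteq> 0" "\<forall>k\<in>interior K. 0 \<le> a \<bullet> k"
    using separating_hyperplane_set_0[of "interior K"] convex_interior[OF \<open>convex K\<close>] by auto
  show False
  proof (cases "interior K = {}")
    case True
    then obtain c d where c: "c \<noteq> 0" "K \<subseteq> {x. c \<bullet> x = d}"
      using empty_interior_subset_hyperplane[OF \<open>convex K\<close>] by blast
    then have "c \<bullet> k = 0" if "k \<in> K" for k
      using subsetD[OF c(2) \<open>0 \<in> K\<close>] subsetD[OF c(2) that] by simp
    then show False using sep[of c] c by simp
  next
    case False
    have "closure (interior K) \<subseteq> {x. 0 \<le> a \<bullet> x}"
      using a by (intro closure_minimal closed_halfspace_ge) auto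
    then have "0 \<le> a \<bullet> k" if "k \<in> K" for k
      using convex_closure_interior[OF \<open>convex K\<close> False] closure_subset[of K] that by auto
    then show False using sep[of a] a by simp
  qed
qed

text \<open>
  Restricting to a ball around \<open>w0\<close> loses nothing: a functional that is nonnegative on the
  image of the points of \<open>\<Omega>\<close> near \<open>w0\<close> is nonnegative on the image of all of \<open>\<Omega>\<close>, because
  any \<open>w \<in> \<Omega>\<close> can be pulled towards \<open>w0\<close> along a segment, which scales \<open>T w\<close> by a positive
  factor. The restriction makes the set compact and so allows uniform estimates.
\<close>

lemma zero_in_interior_local_image:
  fixes T :: "'a::euclidean_space \<Rightarrow> 'b::euclidean_space"
  assumes "linear T" and "convex \<Omega>" and "w0 \<in> \<Omega>" and "T w0 = 0"
    and sep: "\<And>z. (\<And>w. w \<in> \<Omega> \<Longrightarrow> 0 \<le> z \<bullet> T w) \<Longrightarrow> z = 0"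
  shows "0 \<in> interior (T ` (\<Omega> \<inter> cball w0 1))"
proof (rule convex_zero_in_interior)
  show "convex (T ` (\<Omega> \<inter> cball w0 1))"
    using assms by (intro convex_linear_image convex_Int convex_cball)
  show "0 \<in> T ` (\<Omega> \<inter> cball w0 1)"
    using assms by (auto intro!: image_eqI[of _ _ w0])
  fix z
  assume loc: "\<And>k. k \<in> T ` (\<Omega> \<inter> cball w0 1) \<Longrightarrow> 0 \<le> z \<bullet> k"
  have "0 \<le> z \<bullet> T w" if "w \<in> \<Omega>" for w
  proof -
    (* any t in (0, 1] with t * norm (w - w0) <= 1 would do; this one needs no case w = w0 *)
    define t where "t = 1 / (1 + norm (w - w0))"
    have t: "0 < t" "t \<le> 1"
      unfolding t_def by (simp_all add: divide_simps add_pos_nonneg)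
    have "norm (w - w0) \<le> 1 + norm (w - w0)"
      by simp
    then have tn: "t * norm (w - w0) \<le> 1"
      unfolding t_def by (simp add: divide_simps add_pos_nonneg)
    define u where "u = w0 + t *\<^sub>R (w - w0)"
    have "u = (1 - t) *\<^sub>R w0 + t *\<^sub>R w"
      by (simp add: u_def algebra_simps)
    then have "u \<in> \<Omega>"
      using convexD[OF \<open>convex \<Omega>\<close> \<open>w0 \<in> \<Omega>\<close> that, of "1 - t" t] t by simp
    moreover have "u \<in> cball w0 1"
      using tn t by (simp add: u_def dist_norm)
    ultimately have "0 \<le> z \<bullet> T u"
      using loc by blast
    also have "T u = t *\<^sub>R T w"
      using \<open>linear T\<close> \<open>T w0 = 0\<close> by (simp add: u_def linear_add linear_diff linear_scale)
    finally show ?thesis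
      using t by (simp add: zero_le_mult_iff)
  qed
  then show "z = 0" by (rule sep)
qed

text \<open>
  A point \<open>v\<close> of the smaller ball outside the compact convex set \<open>T' ` D\<close> could be strictly
  separated from it by some \<open>a\<close>. But \<open>T\<close> attains the value \<open>- r\<close> times the unit vector of \<open>a\<close>
  on \<open>D\<close>, and there \<open>T'\<close> differs from \<open>T\<close> by at most \<open>r / 2\<close>, so \<open>a \<bullet> T' w\<close> falls to
  \<open>- norm a * r / 2 \<le> a \<bullet> v\<close>.
\<close>

lemma cball_subset_perturbed_image:
  fixes T T' :: "'a::euclidean_space \<Rightarrow> 'b::euclidean_space"
  assumes "linear T'" and "convex D" and "compact D"
    and cover: "cball 0 r \<subseteq> T ` D" and "0 \<le> r"
    and close: "\<And>w. w \<in> D \<Longrightarrow> norm (T' w - T w) \<le> r / 2"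
  shows "cball 0 (r / 2) \<subseteq> T' ` D"
proof (rule ccontr)
  assume "\<not> cball 0 (r / 2) \<subseteq> T' ` D"
  then obtain v where v: "norm v \<le> r / 2" "v \<notin> T' ` D"
    by (metis mem_cball_0 subsetI)
  have "convex (T' ` D)"
    using assms by (intro convex_linear_image)
  moreover have "closed (T' ` D)"
    using assms
    by (intro compact_imp_closed compact_continuous_image linear_continuous_on linear_conv_bounded_linear[THEN iffD1])
  ultimately obtain a b where ab: "a \<bullet> v < b" "\<forall>x\<in>T' ` D. b < a \<bullet> x"
    using separating_hyperplane_closed_point[of "T' ` D" v] v(2) by auto
  have "- (r *\<^sub>R sgn a) \<in> cball 0 r"
    using \<open>0 \<le> r\<close> by (simp add: norm_sgn)
  then obtain w where w: "w \<in> D" "T w = - (r *\<^sub>R sgn a)"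
    using cover by (metis imageE subsetD)
  have as: "a \<bullet> sgn a = norm a"
    by (cases "a = 0") (simp_all add: sgn_div_norm dot_square_norm power2_eq_square)
  have "a \<bullet> T' w = a \<bullet> T w + a \<bullet> (T' w - T w)"
    by (simp add: inner_diff_right)
  also have "\<dots> \<le> - (r * norm a) + norm a * (r / 2)"
  proof (rule add_mono)
    show "a \<bullet> T w \<le> - (r * norm a)"
      by (simp add: w(2) as)
    show "a \<bullet> (T' w - T w) \<le> norm a * (r / 2)"
      using norm_cauchy_schwarz[of a "T' w - T w"] mult_left_mono[OF close[OF w(1)] norm_ge_zero[of a]]
      by linarith
  qed
  also have "\<dots> = - (norm a * (r / 2))"
    by simp
  also have "\<dots> \<le> - (norm a * norm v)"
    using mult_left_mono[OF v(1) norm_ge_zero[of a]] by linarith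
  also have "\<dots> \<le> a \<bullet> v"
    using norm_cauchy_schwarz[of "- a" v] by simp
  finally show False
    using ab w(1) by force
qed

section \<open>Correcting the residual within a convex set\<close>

text \<open>
  A Hoffman-type error bound in the manner of Robinson and Ursescu: choose \<open>u \<in> D\<close> whose
  residual points opposite to that of \<open>w\<close> and has norm \<open>s\<close>. The residuals cancel at a convex
  combination of \<open>w\<close> and \<open>u\<close>, with weight of \<open>u\<close> at most \<open>norm (T w) / s\<close>.
\<close>

lemma convex_solution_near:
  fixes T :: "'a::real_normed_vector \<Rightarrow> 'b::real_normed_vector"
  assumes "linear T" and "convex \<Omega>" and "D \<subseteq> \<Omega>" and "w \<in> \<Omega>" and "0 < s"
    and cover: "cball 0 s \<subseteq> T ` D"
    and diam: "\<And>u. u \<in> D \<Longrightarrow> norm (u - w) \<le> d"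
  obtains v where "v \<in> \<Omega>" and "T v = 0" and "norm (w - v) \<le> (d / s) * norm (T w)"
proof (cases "T w = 0")
  case True
  then show thesis using that[of w] \<open>w \<in> \<Omega>\<close> by simp
next
  case False
  define n where "n = norm (T w)"
  have n: "0 < n" using False by (simp add: n_def)
  have "- (s / n) *\<^sub>R T w \<in> cball 0 s"
    using \<open>0 < s\<close> n by (simp add: n_def)
  then obtain u where u: "u \<in> D" "T u = - (s / n) *\<^sub>R T w"
    using cover by (metis imageE subsetD)
  (* the weight t that solves (1 - t) * n = t * s *)
  define t where "t = n / (n + s)"
  have t: "0 \<le> t" "t \<le> 1" and ts: "t * (s / n) = 1 - t" and tle: "t \<le> n / s"
    using n \<open>0 < s\<close> unfolding t_def by (simp_all add: field_simps)
  define v where "v = (1 - t) *\<^sub>R w + t *\<^sub>R u"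
  have Tv: "T v = (1 - t) *\<^sub>R T w - (t * (s / n)) *\<^sub>R T w"
    using \<open>linear T\<close> by (simp add: v_def linear_add linear_scale u)
  have "w - v = - (t *\<^sub>R (u - w))"
    by (simp add: v_def algebra_simps)
  then have "norm (w - v) = t * norm (u - w)"
    using t by simp
  also have "\<dots> \<le> (n / s) * d"
    using t tle diam[OF u(1)] n \<open>0 < s\<close> by (intro mult_mono) auto
  finally have "norm (w - v) \<le> (d / s) * norm (T w)"
    by (simp add: n_def mult.commute)
  moreover have "v \<in> \<Omega>"
    unfolding v_def using u t assms by (intro convexD) auto
  moreover have "T v = 0"
    using Tv unfolding ts by simp
  ultimately show thesis using that by blast
qed

section \<open>The Lipschitz-like property in terms of distances\<close>

text \<open>
  Passes from points \<open>q + c b\<close> with \<open>b\<close> in the unit ball to the distance estimate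
  \<open>nY (w - q) \<le> c\<close>. Definiteness of \<open>nY\<close> covers the case \<open>c = 0\<close>, where \<open>w - q\<close> cannot be
  divided by \<open>c\<close>.
\<close>

lemma lipschitz_like_iff_dist:
  assumes nX: "\<And>x. 0 \<le> nX x" and nn: "\<And>y. 0 \<le> nY y"
    and nY: "\<And>c y. nY (c *\<^sub>R y) = \<bar>c\<bar> * nY y" "\<And>y. nY y = 0 \<Longrightarrow> y = 0"
  shows "lipschitz_like nX nY \<Phi> p0 q0 \<longleftrightarrow>
    q0 \<in> \<Phi> p0 \<and>
    (\<exists>U V. \<exists>L>0. p0 \<in> interior U \<and> q0 \<in> interior V \<and>
      (\<forall>p\<in>U. \<forall>p'\<in>U. \<forall>w \<in> \<Phi> p' \<inter> V. \<exists>q\<in>\<Phi> p. nY (w - q) \<le> L * nX (p' - p)))"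
proof -
  have ball: "(\<exists>b. w = q + c *\<^sub>R b \<and> nY b \<le> 1) \<longleftrightarrow> nY (w - q) \<le> c" if "0 \<le> c" for c w q
  proof
    assume "\<exists>b. w = q + c *\<^sub>R b \<and> nY b \<le> 1"
    then show "nY (w - q) \<le> c"
      using that nY(1) by (auto simp: mult_left_le)
  next
    assume *: "nY (w - q) \<le> c"
    show "\<exists>b. w = q + c *\<^sub>R b \<and> nY b \<le> 1"
    proof (cases "c = 0")
      case True
      then have "w - q = 0" using * nn[of "w - q"] nY(2)[of "w - q"] by simp
      then show ?thesis using nY(1)[of 0 0] True by (intro exI[of _ 0]) auto
    next
      case False
      then show ?thesis
        using * that by (intro exI[of _ "(1 / c) *\<^sub>R (w - q)"]) (simp add: nY(1))
    qed
  qed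
  have "w \<in> {q + (L * nX (p' - p)) *\<^sub>R b |q b. q \<in> \<Phi> p \<and> nY b \<le> 1} \<longleftrightarrow>
      (\<exists>q\<in>\<Phi> p. nY (w - q) \<le> L * nX (p' - p))" if "0 < L" for w L p p'
  proof -
    have "0 \<le> L * nX (p' - p)"
      using nX[of "p' - p"] that by simp
    from ball[OF this] show ?thesis
      by blast
  qed
  then show ?thesis
    unfolding lipschitz_like_def subset_iff
    by (intro conj_cong ex_cong1 ball_cong refl) (auto simp: Ball_def)
qed

lemma lipschitz_like_norm_iff:
  fixes \<Phi> :: "'a::real_normed_vector \<Rightarrow> 'b::real_normed_vector set"
  shows "lipschitz_like norm norm \<Phi> p0 q0 \<longleftrightarrow>
    q0 \<in> \<Phi> p0 \<and>
    (\<exists>U V. \<exists>L>0. p0 \<in> interior U \<and> q0 \<in> interior V \<and>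
      (\<forall>p\<in>U. \<forall>p'\<in>U. \<forall>w \<in> \<Phi> p' \<inter> V. \<exists>q\<in>\<Phi> p. norm (w - q) \<le> L * norm (p' - p)))"
  by (rule lipschitz_like_iff_dist) auto

text \<open>
  The norms are equivalent with factor \<open>2\<close>, so passing from one to the other at most doubles
  the constant \<open>L\<close>.
\<close>

lemma lipschitz_like_sum_norm_iff:
  fixes \<Phi> :: "'a::real_normed_vector \<times> 'b::real_normed_vector \<Rightarrow>
    ('c::real_normed_vector \<times> 'd::real_normed_vector) set"
  shows "lipschitz_like sum_norm sum_norm \<Phi> p0 q0 \<longleftrightarrow> lipschitz_like norm norm \<Phi> p0 q0"
proof -
  let ?P = "\<lambda>nX nY U V L. \<forall>p\<in>U. \<forall>p'\<in>U. \<forall>w \<in> \<Phi> p' \<inter> V. \<exists>q\<in>\<Phi> p. nY (w - q) \<le> L * nX (p' - p)"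
  have nn: "0 \<le> sum_norm x" for x :: "'x::real_normed_vector \<times> 'y::real_normed_vector"
    by (simp add: sum_norm_def)
  have hom: "sum_norm (c *\<^sub>R y) = \<bar>c\<bar> * sum_norm y"
    for c and y :: "'x::real_normed_vector \<times> 'y::real_normed_vector"
    by (simp add: sum_norm_def distrib_left)
  have def0: "sum_norm y = 0 \<Longrightarrow> y = 0" for y :: "'x::real_normed_vector \<times> 'y::real_normed_vector"
    using norm_le_sum_norm[of y] by simp
  have to_norm: "?P norm norm U V (2 * L)" if P: "?P sum_norm sum_norm U V L" "0 < L" for U V L
  proof (intro ballI)
    fix p p' w assume "p \<in> U" "p' \<in> U" "w \<in> \<Phi> p' \<inter> V"
    then obtain q where q: "q \<in> \<Phi> p" "sum_norm (w - q) \<le> L * sum_norm (p' - p)"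
      using P by blast
    have "L * sum_norm (p' - p) \<le> 2 * L * norm (p' - p)"
      using sum_norm_le_norm[of "p' - p"] \<open>0 < L\<close> by simp
    then show "\<exists>q\<in>\<Phi> p. norm (w - q) \<le> 2 * L * norm (p' - p)"
      using q norm_le_sum_norm[of "w - q"] by force
  qed
  have to_sum: "?P sum_norm sum_norm U V (2 * L)" if P: "?P norm norm U V L" "0 < L" for U V L
  proof (intro ballI)
    fix p p' w assume "p \<in> U" "p' \<in> U" "w \<in> \<Phi> p' \<inter> V"
    then obtain q where q: "q \<in> \<Phi> p" "norm (w - q) \<le> L * norm (p' - p)"
      using P by blast
    have "L * norm (p' - p) \<le> L * sum_norm (p' - p)"
      using norm_le_sum_norm[of "p' - p"] \<open>0 < L\<close> by simp
    then show "\<exists>q\<in>\<Phi> p. sum_norm (w - q) \<le> 2 * L * sum_norm (p' - p)"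
      using q sum_norm_le_norm[of "w - q"] by force
  qed
  have "(\<exists>U V. \<exists>L>0. p0 \<in> interior U \<and> q0 \<in> interior V \<and> ?P sum_norm sum_norm U V L) \<longleftrightarrow>
      (\<exists>U V. \<exists>L>0. p0 \<in> interior U \<and> q0 \<in> interior V \<and> ?P norm norm U V L)"
    (is "?l \<longleftrightarrow> ?r")
  proof
    assume ?l
    then obtain U V L where *: "L > 0" "p0 \<in> interior U" "q0 \<in> interior V" "?P sum_norm sum_norm U V L"
      by blast
    show ?r
      by (rule exI[of _ U], rule exI[of _ V], rule exI[of _ "2 * L"]) (use * to_norm[OF *(4,1)] in simp)
  next
    assume ?r
    then obtain U V L where *: "L > 0" "p0 \<in> interior U" "q0 \<in> interior V" "?P norm norm U V L"
      by blast
    show ?l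
      by (rule exI[of _ U], rule exI[of _ V], rule exI[of _ "2 * L"]) (use * to_sum[OF *(4,1)] in simp)
  qed
  then show ?thesis
    by (simp add: lipschitz_like_iff_dist[of sum_norm sum_norm, OF nn nn hom def0] lipschitz_like_norm_iff)
qed

section \<open>Bilinear constraints on a convex set\<close>

text \<open>
  The hypothesis \<open>sep\<close> is the dual form of Robinson's constraint qualification
  \<open>0 \<in> interior (G p0 ` \<Omega>)\<close>. The image of the unit-ball piece \<open>D\<close> of \<open>\<Omega>\<close> covers a ball around
  \<open>0\<close> uniformly in \<open>p\<close> near \<open>p0\<close>, so a solution for \<open>p'\<close> can be corrected to one for \<open>p\<close> at a
  cost proportional to its residual \<open>G p w = G (p - p') w\<close>.
\<close>

lemma lipschitz_like_bilinear_constraint: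
  fixes G :: "'p::real_normed_vector \<Rightarrow> 'a::euclidean_space \<Rightarrow> 'b::euclidean_space"
  assumes "bounded_bilinear G" and "closed \<Omega>" and "convex \<Omega>" and "w0 \<in> \<Omega>" and "G p0 w0 = 0"
    and sep: "\<And>z. (\<And>w. w \<in> \<Omega> \<Longrightarrow> 0 \<le> z \<bullet> G p0 w) \<Longrightarrow> z = 0"
  shows "lipschitz_like norm norm (\<lambda>p. {w \<in> \<Omega>. G p w = 0}) p0 w0"
proof -
  interpret G: bounded_bilinear G by fact
  have lin: "linear (G p)" for p
    by (rule bounded_linear.linear) (rule G.bounded_linear_right)
  define D where "D = \<Omega> \<inter> cball w0 1"
  obtain K where K: "0 < K" "\<And>p w. norm (G p w) \<le> norm p * norm w * K"
    using G.pos_bounded by blast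
  define M where "M = norm w0 + 1"
  have "0 < M" by (simp add: M_def add_nonneg_pos)
  have wM: "norm w \<le> M" if "w \<in> cball w0 1" for w
    using that norm_triangle_ineq2[of w w0] by (simp add: M_def dist_norm norm_minus_commute)
  have GM: "norm (G p w) \<le> norm p * (M * K)" if "w \<in> cball w0 1" for p w
  proof -
    have "norm p * norm w * K \<le> norm p * M * K"
      using wM[OF that] \<open>0 < K\<close> by (intro mult_right_mono mult_left_mono) auto
    then show ?thesis using K(2)[of p w] by (simp add: mult.assoc)
  qed
  have "0 \<in> interior (G p0 ` D)"
    unfolding D_def using zero_in_interior_local_image[OF lin] assms by blast
  then obtain r where r: "0 < r" "cball 0 r \<subseteq> G p0 ` D"
    by (auto simp: mem_interior_cball)
  (* radius chosen so that G p moves by at most r / 2 on D *)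
  define U where "U = cball p0 (r / (2 * (M * K)))"
  have cover: "cball 0 (r / 2) \<subseteq> G p ` D" if "p \<in> U" for p
  proof (rule cball_subset_perturbed_image[OF lin _ _ r(2)])
    show "convex D" "compact D"
      using assms by (auto simp: D_def intro!: convex_Int closed_Int_compact)
    fix w assume "w \<in> D"
    have "norm (G p w - G p0 w) \<le> norm (p - p0) * (M * K)"
      using GM[of w "p - p0"] \<open>w \<in> D\<close> by (simp add: D_def G.diff_left)
    also have "\<dots> \<le> r / (2 * (M * K)) * (M * K)"
      using that \<open>0 < M\<close> \<open>0 < K\<close>
      by (intro mult_right_mono) (simp_all add: U_def dist_norm norm_minus_commute)
    also have "\<dots> = r / 2"
      using \<open>0 < M\<close> \<open>0 < K\<close> by simp
    finally show "norm (G p w - G p0 w) \<le> r / 2" .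
  qed (use r in simp)
  have est: "\<exists>v\<in>{w \<in> \<Omega>. G p w = 0}. norm (w - v) \<le> 4 / r * (M * K) * norm (p' - p)"
    if p: "p \<in> U" and w: "w \<in> {w \<in> \<Omega>. G p' w = 0} \<inter> cball w0 1" for p p' w
  proof -
    have "norm (u - w) \<le> 2" if "u \<in> D" for u
    proof -
      have "dist u w \<le> dist u w0 + dist w0 w" by (rule dist_triangle)
      then show ?thesis
        using that w by (simp add: D_def dist_norm norm_minus_commute)
    qed
    moreover have "D \<subseteq> \<Omega>" by (simp add: D_def)
    ultimately obtain v where v: "v \<in> \<Omega>" "G p v = 0" "norm (w - v) \<le> (2 / (r / 2)) * norm (G p w)"
      using convex_solution_near[OF lin \<open>convex \<Omega>\<close> _ _ _ cover[OF p], of w 2] r(1) w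
      by auto
    have "G p w = G (p - p') w"
      using w by (simp add: G.diff_left)
    then have "norm (G p w) \<le> norm (p' - p) * (M * K)"
      using GM[of w "p - p'"] w by (simp add: norm_minus_commute)
    then have "2 / (r / 2) * norm (G p w) \<le> 2 / (r / 2) * (norm (p' - p) * (M * K))"
      using r(1) by (intro mult_left_mono) auto
    then show ?thesis
      using v by (auto simp: mult_ac)
  qed
  have "0 < r / (2 * (M * K))"
    using r \<open>0 < M\<close> \<open>0 < K\<close> by simp
  then have nbhd: "p0 \<in> interior U" "w0 \<in> interior (cball w0 1)"
    unfolding U_def mem_interior_cball using zero_less_one by blast+
  have "0 < 4 / r * (M * K)"
    using r \<open>0 < M\<close> \<open>0 < K\<close> by simp
  moreover have "\<forall>p\<in>U. \<forall>p'\<in>U. \<forall>w \<in> {w \<in> \<Omega>. G p' w = 0} \<inter> cball w0 1.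
      \<exists>v\<in>{w \<in> \<Omega>. G p w = 0}. norm (w - v) \<le> 4 / r * (M * K) * norm (p' - p)"
    by (intro ballI est)
  moreover have "w0 \<in> {w \<in> \<Omega>. G p0 w = 0}"
    using assms by simp
  ultimately show ?thesis
    unfolding lipschitz_like_norm_iff using nbhd by blast
qed

text \<open>
  Moving the parameter from \<open>p0\<close> in the direction \<open>p\<close> adds a positive multiple of \<open>G p w\<close>,
  which is close to \<open>z\<close> for \<open>w\<close> near \<open>w0\<close>. Together with \<open>sep\<close> this pushes \<open>z \<bullet> G (p0 + t p) w\<close>
  strictly above \<open>0\<close>, so that no solutions remain near \<open>w0\<close> unless \<open>z = 0\<close>.
\<close>

lemma constraint_regular_if_lipschitz_like:
  fixes G :: "'p::real_normed_vector \<Rightarrow> 'a::real_normed_vector \<Rightarrow> 'b::real_inner"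
  assumes "bounded_bilinear G"
    and lip: "lipschitz_like norm norm (\<lambda>p. {w \<in> \<Omega>. G p w = 0}) p0 w0"
    and "G p w0 = z"
    and sep: "\<And>w. w \<in> \<Omega> \<Longrightarrow> 0 \<le> z \<bullet> G p0 w"
  shows "z = 0"
proof (rule ccontr)
  assume "z \<noteq> 0"
  interpret G: bounded_bilinear G by fact
  obtain U V L where w0: "w0 \<in> \<Omega>" "G p0 w0 = 0" and "0 < L"
    and UV: "p0 \<in> interior U" "w0 \<in> interior V"
    and est: "\<And>p p' w. \<lbrakk>p \<in> U; p' \<in> U; w \<in> \<Omega>; G p' w = 0; w \<in> V\<rbrakk> \<Longrightarrow>
      \<exists>q. q \<in> \<Omega> \<and> G p q = 0 \<and> norm (w - q) \<le> L * norm (p' - p)"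
  proof -
    from lip obtain U V L where "w0 \<in> {w \<in> \<Omega>. G p0 w = 0}" "0 < L" "p0 \<in> interior U" "w0 \<in> interior V"
      and "\<forall>p\<in>U. \<forall>p'\<in>U. \<forall>w \<in> {w \<in> \<Omega>. G p' w = 0} \<inter> V. \<exists>q\<in>{w \<in> \<Omega>. G p w = 0}.
        norm (w - q) \<le> L * norm (p' - p)"
      unfolding lipschitz_like_norm_iff by blast
    then show thesis by (intro that[of L U V]) auto
  qed
  have "open {w. 0 < z \<bullet> G p w}"
    by (intro open_Collect_less continuous_intros G.bounded_linear_right[THEN linear_continuous_on])
  moreover have "w0 \<in> {w. 0 < z \<bullet> G p w}"
    using \<open>z \<noteq> 0\<close> \<open>G p w0 = z\<close> by simp
  ultimately obtain e where e: "0 < e" "\<And>w. dist w w0 < e \<Longrightarrow> 0 < z \<bullet> G p w"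
    by (auto simp: open_dist)
  have "((\<lambda>t. p0 + t *\<^sub>R p) \<longlongrightarrow> p0 + 0 *\<^sub>R p) (at_right 0)"
    by (intro tendsto_intros)
  then have "\<forall>\<^sub>F t in at_right 0. p0 + t *\<^sub>R p \<in> interior U"
    using UV by (intro topological_tendstoD) auto
  moreover have "((\<lambda>t. L * norm (t *\<^sub>R p)) \<longlongrightarrow> L * norm (0 *\<^sub>R p)) (at_right 0)"
    by (intro tendsto_intros)
  then have "\<forall>\<^sub>F t in at_right 0. L * norm (t *\<^sub>R p) < e"
    using e by (intro order_tendstoD) auto
  moreover have "\<forall>\<^sub>F t in at_right 0. (0::real) < t"
    by (rule eventually_at_right_less)
  ultimately have "\<forall>\<^sub>F t in at_right 0. (0::real) < t \<and> p0 + t *\<^sub>R p \<in> interior U \<and> L * norm (t *\<^sub>R p) < e"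
    by eventually_elim simp
  then obtain t :: real where t: "0 < t" "p0 + t *\<^sub>R p \<in> interior U" "L * norm (t *\<^sub>R p) < e"
    using eventually_happens'[OF trivial_limit_at_right_real] by blast
  obtain q where q: "q \<in> \<Omega>" "G (p0 + t *\<^sub>R p) q = 0" "norm (w0 - q) \<le> L * norm (p0 - (p0 + t *\<^sub>R p))"
    using est[of "p0 + t *\<^sub>R p" p0 w0] w0 UV[THEN subsetD[OF interior_subset]]
      t(2)[THEN subsetD[OF interior_subset]] by auto
  have "0 < z \<bullet> G p q"
    using q(3) t(3) by (intro e(2)) (simp add: dist_norm norm_minus_commute)
  moreover have "0 = z \<bullet> G p0 q + t * (z \<bullet> G p q)"
    using arg_cong[OF q(2), of "\<lambda>v. z \<bullet> v"] by (simp add: G.add_left G.scaleR_left inner_add_right)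
  ultimately show False
    using sep[OF q(1)] mult_pos_pos[OF t(1), of "z \<bullet> G p q"] by linarith
qed

section \<open>The split equality problem\<close>

definition sep_residual ::
  "(real ^ 'n ^ 'l) \<times> (real ^ 'm ^ 'l) \<Rightarrow> (real ^ 'n) \<times> (real ^ 'm) \<Rightarrow> real ^ 'l" where
  "sep_residual p w = fst p *v fst w - snd p *v snd w"

lemma bounded_bilinear_sep_residual: "bounded_bilinear sep_residual"
proof -
  have "bilinear sep_residual"
    unfolding bilinear_def
    by (auto intro!: linearI simp: sep_residual_def algebra_simps scaleR_matrix_vector_assoc)
  then show ?thesis
    by (simp add: bilinear_conv_bounded_bilinear)
qed

lemma sep_solution_eq_residual:
  "sep_solution C Q = (\<lambda>p. {w \<in> C \<times> Q. sep_residual p w = 0})"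
  by (auto simp: sep_solution_def sep_residual_def fun_eq_iff)

text \<open>
  This is where \<open>(xbar, ybar) \<noteq> (0, 0)\<close> enters: at \<open>w = 0\<close> every residual vanishes. A nonzero
  component \<open>a\<close> of \<open>w\<close> is sent to any prescribed vector by a rank-one matrix, and the other
  matrix can be taken to be zero.
\<close>

lemma sep_residual_eval_surj:
  fixes w :: "(real ^ 'n) \<times> (real ^ 'm)" and z :: "real ^ 'l"
  assumes "w \<noteq> 0"
  shows "\<exists>p. sep_residual p w = z"
proof -
  have rank1: "\<exists>A :: real ^ 'k ^ 'l. A *v a = v" if "a \<noteq> 0" for a :: "real ^ 'k" and v
  proof
    have "linear (\<lambda>x. ((a \<bullet> x) / (a \<bullet> a)) *\<^sub>R v)"
      by (auto intro!: linearI simp: inner_add_right add_divide_distrib scaleR_add_left)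
    then show "matrix (\<lambda>x. ((a \<bullet> x) / (a \<bullet> a)) *\<^sub>R v) *v a = v"
      using that by (simp add: matrix_works)
  qed
  show ?thesis
  proof (cases "fst w = 0")
    case False
    then obtain A :: "real ^ 'n ^ 'l" where "A *v fst w = z" using rank1 by blast
    then show ?thesis by (intro exI[of _ "(A, 0)"]) (simp add: sep_residual_def)
  next
    case True
    then have "snd w \<noteq> 0" using assms by (simp add: prod_eq_iff)
    then obtain B :: "real ^ 'm ^ 'l" where "B *v snd w = - z" using rank1 by blast
    then show ?thesis
      by (intro exI[of _ "(0, B)"]) (simp add: sep_residual_def)
  qed
qed

text \<open>
  The two normal cone conditions say that \<open>z \<bullet> (A u)\<close> is minimal over \<open>C\<close> at \<open>x\<close> and that
  \<open>z \<bullet> (B v)\<close> is maximal over \<open>Q\<close> at \<open>y\<close>. Because these two extreme values agree, both hold iff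
  every value of the first function is at least every value of the second.
\<close>

lemma dual_cone_condition_iff:
  fixes A :: "real ^ 'n ^ 'l" and B :: "real ^ 'm ^ 'l"
  assumes "x \<in> C" and "y \<in> Q" and "A *v x = B *v y"
  shows "z \<in> (\<lambda>z. transpose A *v z) -` (uminus ` normal_cone x C)
        \<inter> (\<lambda>z. transpose B *v z) -` normal_cone y Q \<longleftrightarrow>
    (\<forall>w\<in>C \<times> Q. 0 \<le> z \<bullet> sep_residual (A, B) w)"
proof -
  have neg: "a \<in> uminus ` S \<longleftrightarrow> - a \<in> S" for a :: "real ^ 'n" and S
    by (metis image_iff minus_minus)
  have "z \<in> (\<lambda>z. transpose A *v z) -` (uminus ` normal_cone x C)
        \<inter> (\<lambda>z. transpose B *v z) -` normal_cone y Q \<longleftrightarrow>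
    (\<forall>u\<in>C. z \<bullet> (A *v x) \<le> z \<bullet> (A *v u)) \<and> (\<forall>v\<in>Q. z \<bullet> (B *v v) \<le> z \<bullet> (B *v y))"
    by (simp add: neg normal_cone_def dot_lmul_matrix matrix_vector_mult_diff_distrib inner_diff_right)
  also have "\<dots> \<longleftrightarrow> (\<forall>u\<in>C. \<forall>v\<in>Q. z \<bullet> (B *v v) \<le> z \<bullet> (A *v u))"
  proof (intro iffI conjI ballI)
    fix u v
    assume "(\<forall>u\<in>C. z \<bullet> (A *v x) \<le> z \<bullet> (A *v u)) \<and> (\<forall>v\<in>Q. z \<bullet> (B *v v) \<le> z \<bullet> (B *v y))"
      and "u \<in> C" "v \<in> Q"
    then have "z \<bullet> (B *v v) \<le> z \<bullet> (B *v y)" "z \<bullet> (A *v x) \<le> z \<bullet> (A *v u)"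
      by auto
    then show "z \<bullet> (B *v v) \<le> z \<bullet> (A *v u)"
      using assms(3) by simp
  qed (use assms in \<open>metis+\<close>)
  also have "\<dots> \<longleftrightarrow> (\<forall>w\<in>C \<times> Q. 0 \<le> z \<bullet> sep_residual (A, B) w)"
    by (auto simp: sep_residual_def inner_diff_right)
  finally show ?thesis .
qed

theorem theorem3p1:
  fixes C :: "(real ^ 'n) set" and Q :: "(real ^ 'm) set"
    and Abar :: "real ^ 'n ^ 'l" and Bbar :: "real ^ 'm ^ 'l"
    and xbar :: "real ^ 'n" and ybar :: "real ^ 'm"
  assumes "C \<noteq> {}" and "closed C" and "convex C"
    and "Q \<noteq> {}" and "closed Q" and "convex Q"
    and "(xbar, ybar) \<in> sep_solution C Q (Abar, Bbar)"
  shows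
    "((\<lambda>z. transpose Abar *v z) -` (uminus ` normal_cone xbar C)
        \<inter> (\<lambda>z. transpose Bbar *v z) -` normal_cone ybar Q = {0}
      \<longrightarrow> lipschitz_like sum_norm sum_norm (sep_solution C Q) (Abar, Bbar) (xbar, ybar))
    \<and> (lipschitz_like sum_norm sum_norm (sep_solution C Q) (Abar, Bbar) (xbar, ybar)
        \<and> (xbar, ybar) \<noteq> (0, 0)
      \<longrightarrow> (\<lambda>z. transpose Abar *v z) -` (uminus ` normal_cone xbar C)
        \<inter> (\<lambda>z. transpose Bbar *v z) -` normal_cone ybar Q = {0})"
    (is "(?N = {0} \<longrightarrow> ?lip) \<and> (?lip \<and> _ \<longrightarrow> _)")
proof -
  have sol: "xbar \<in> C" "ybar \<in> Q" "Abar *v xbar = Bbar *v ybar"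
    using assms(7) by (auto simp: sep_solution_def)
  have N: "z \<in> ?N \<longleftrightarrow> (\<forall>w\<in>C \<times> Q. 0 \<le> z \<bullet> sep_residual (Abar, Bbar) w)" for z
    using dual_cone_condition_iff[OF sol] .
  have lip: "?lip \<longleftrightarrow> lipschitz_like norm norm
      (\<lambda>p. {w \<in> C \<times> Q. sep_residual p w = 0}) (Abar, Bbar) (xbar, ybar)"
    by (simp only: lipschitz_like_sum_norm_iff sep_solution_eq_residual)
  show ?thesis
  proof (intro conjI impI)
    assume "?N = {0}"
    then have sep: "z = 0" if "\<And>w. w \<in> C \<times> Q \<Longrightarrow> 0 \<le> z \<bullet> sep_residual (Abar, Bbar) w" for z
    proof -
      have "z \<in> ?N"
        unfolding N using that by (rule ballI)
      then show ?thesis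
        unfolding \<open>?N = {0}\<close> by simp
    qed
    show ?lip
      unfolding lip
    proof (rule lipschitz_like_bilinear_constraint[OF bounded_bilinear_sep_residual])
      show "closed (C \<times> Q)" "convex (C \<times> Q)" "(xbar, ybar) \<in> C \<times> Q"
        using assms sol by (auto intro: closed_Times convex_Times)
      show "sep_residual (Abar, Bbar) (xbar, ybar) = 0"
        using sol by (simp add: sep_residual_def)
    qed (rule sep)
  next
    assume *: "?lip \<and> (xbar, ybar) \<noteq> (0, 0)"
    have "z = 0" if z: "z \<in> ?N" for z
    proof -
      obtain p where p: "sep_residual p (xbar, ybar) = z"
        using sep_residual_eval_surj[of "(xbar, ybar)" z] * by (auto simp: zero_prod_def)
      have "0 \<le> z \<bullet> sep_residual (Abar, Bbar) w" if "w \<in> C \<times> Q" for w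
        using z that unfolding N by (rule bspec)
      then show ?thesis
        using constraint_regular_if_lipschitz_like[OF bounded_bilinear_sep_residual
            *[THEN conjunct1, unfolded lip] p] by simp
    qed
    moreover have "0 \<in> ?N"
      unfolding N by simp
    ultimately show "?N = {0}"
      by (intro equalityI subsetI insertI1) auto
  qed
qed

end
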